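(* Let $F$ be a forest, let $e_1,e_2$ be two disjoint edges of $F$, and let $\tau$ be a 2-switch over $F$ that is nontrivial for $F$ and deletes $e_1$ and $e_2$ (i.e., $\tau=\binom{a\ b}{c\ d}$ with $e_1=ab$, $e_2=cd$, interchangeable in $F$). Then: (1) if $e_1$ and $e_2$ lie in the same connected component $T$ of $F$, then $\tau$ is an f-switch over $F$ if and only if $\tau$ is a t-switch over $T$; (2) if $e_1$ and $e_2$ lie in different connected components of $F$, then $\tau$ is an f-switch over $F$.
   Context: Graphs are finite, simple, undirected and labeled. The matrix $\binom{a\ b}{c\ d}$ is interchangeable in a graph $G$ if $ab,cd\in E(G)$, $\{a,b\}\cap\{c,d\}=\varnothing$ and $ac,bd\notin E(G)$; the 2-switch $\tau=\binom{a\ b}{c\ d}$ maps $G$ to $G-ab-cd+ac+bd$ if the matrix is interchangeable in $G$, and to $G$ otherwise; it is nontrivial for $G$ if the matrix is interchangeable in $G$. A nontrivial 2-switch $\tau$ over a tree $T$ is a t-switch if $\tau(T)$ is a tree; a nontrivial 2-switch $\tau$ over a forest $F$ is an f-switch if $\tau(F)$ is a forest. *)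

theory Defs
  imports "Graph_Theory.Graph_Theory"
begin

text \<open>
  A finite simple undirected graph is a \<open>pair_graph\<close>: a finite loop-free digraph without parallel
  arcs whose arc relation is symmetric. The undirected edge \<open>uv\<close> corresponds to the two arcs
  \<open>(u, v)\<close> and \<open>(v, u)\<close>.
\<close>

definition uedges :: "'a pair_pre_digraph \<Rightarrow> 'a set set" where
  "uedges G = {{u, v} | u v. (u, v) \<in> parcs G}"

text \<open>
  The library's \<open>forest\<close> and \<open>tree\<close> are of no use here: a directed cycle may have length 2, so every
  symmetric digraph with an arc contains one. Directed cycles of length at least 3 in a
  \<open>pair_graph\<close> are precisely the (oriented, rooted) cycles of the undirected graph.
\<close>

definition simple_forest :: "'a pair_pre_digraph \<Rightarrow> bool" where
  "simple_forest G \<longleftrightarrow>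
     pair_graph G \<and> \<not> (\<exists>p. pre_digraph.cycle (with_proj G) p \<and> length p \<ge> 3)"

definition simple_tree :: "'a pair_pre_digraph \<Rightarrow> bool" where
  "simple_tree G \<longleftrightarrow> simple_forest G \<and> Digraph_Component.connected (with_proj G)"

definition component_of :: "'a pair_pre_digraph \<Rightarrow> 'a pair_pre_digraph \<Rightarrow> bool" where
  "component_of T G \<longleftrightarrow>
     pre_digraph.max_subgraph (with_proj G) Digraph_Component.connected (with_proj T)"

text \<open>In the following, the arguments \<open>a b c d\<close> stand for the matrix with rows \<open>a b\<close> and \<open>c d\<close>.\<close>

definition interchangeable :: "'a \<Rightarrow> 'a \<Rightarrow> 'a \<Rightarrow> 'a \<Rightarrow> 'a pair_pre_digraph \<Rightarrow> bool" where
  "interchangeable a b c d G \<longleftrightarrow>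
     {a, b} \<in> uedges G \<and> {c, d} \<in> uedges G \<and> {a, b} \<inter> {c, d} = {} \<and>
     {a, c} \<notin> uedges G \<and> {b, d} \<notin> uedges G"

definition two_switch ::
  "'a \<Rightarrow> 'a \<Rightarrow> 'a \<Rightarrow> 'a \<Rightarrow> 'a pair_pre_digraph \<Rightarrow> 'a pair_pre_digraph" where
  "two_switch a b c d G =
     (if interchangeable a b c d G
      then \<lparr> pverts = pverts G,
             parcs = (parcs G - {(a, b), (b, a), (c, d), (d, c)})
                       \<union> {(a, c), (c, a), (b, d), (d, b)} \<rparr>
      else G)"

definition t_switch :: "'a \<Rightarrow> 'a \<Rightarrow> 'a \<Rightarrow> 'a \<Rightarrow> 'a pair_pre_digraph \<Rightarrow> bool" where
  "t_switch a b c d T \<longleftrightarrow>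
     simple_tree T \<and> interchangeable a b c d T \<and> simple_tree (two_switch a b c d T)"

definition f_switch :: "'a \<Rightarrow> 'a \<Rightarrow> 'a \<Rightarrow> 'a \<Rightarrow> 'a pair_pre_digraph \<Rightarrow> bool" where
  "f_switch a b c d F \<longleftrightarrow>
     simple_forest F \<and> interchangeable a b c d F \<and> simple_forest (two_switch a b c d F)"

end

theory Submission
  imports Defs
begin

text \<open>
  A graph is a forest iff each of its edges is a bridge, which is a property of the arc relation
  alone. Adding an edge between two unconnected vertices preserves it. If \<open>ab\<close> and \<open>cd\<close> lie in
  different components, deleting both and then adding \<open>ac\<close> and \<open>bd\<close> one at a time only ever joins
  unconnected vertices. If they lie in the same component \<open>T\<close>, the switch does not touch the rest
  of the forest, so only connectedness of the switched \<open>T\<close> is at stake. Some end of \<open>ab\<close> is linked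
  to some end of \<open>cd\<close> without using these two edges; when the result is acyclic, the link cannot
  run from \<open>a\<close> to \<open>c\<close> or from \<open>b\<close> to \<open>d\<close>, and an \<open>a\<close>-\<open>d\<close> or \<open>b\<close>-\<open>c\<close> link together with the new
  edges \<open>ac\<close> and \<open>bd\<close> keeps all four vertices connected.
\<close>

section \<open>Bridges of a symmetric relation\<close>

definition bridged :: "'a rel \<Rightarrow> bool" where
  "bridged A \<longleftrightarrow> (\<forall>u v. (u, v) \<in> A \<longrightarrow> (u, v) \<notin> (A - {(u, v), (v, u)})\<^sup>*)"

lemma sym_rtranclD: "sym A \<Longrightarrow> (x, y) \<in> A\<^sup>* \<Longrightarrow> (y, x) \<in> A\<^sup>*"
  by (meson symD sym_rtrancl)

lemma bridged_subset:
  assumes "bridged A" "B \<subseteq> A"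
  shows "bridged B"
  unfolding bridged_def
proof (intro allI impI notI)
  fix u v assume "(u, v) \<in> B" "(u, v) \<in> (B - {(u, v), (v, u)})\<^sup>*"
  moreover have "(B - {(u, v), (v, u)})\<^sup>* \<subseteq> (A - {(u, v), (v, u)})\<^sup>*"
    using assms(2) by (intro rtrancl_mono) auto
  ultimately show False using assms unfolding bridged_def by blast
qed

text \<open>A walk needs the edge \<open>uv\<close> at most once. A second crossing in the same
  direction ends where the first one did, and a crossing back returns to the vertex from which the
  first one started; either way the part in between can be cut out.\<close>

lemma rtrancl_insert_edge_cases:
  assumes "(x, y) \<in> (B \<union> {(u, v), (v, u)})\<^sup>*"
  shows "(x, y) \<in> B\<^sup>* \<or> (x, u) \<in> B\<^sup>* \<and> (v, y) \<in> B\<^sup>* \<or> (x, v) \<in> B\<^sup>* \<and> (u, y) \<in> B\<^sup>*"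
  using assms
proof (induction rule: rtrancl_induct)
  case base
  then show ?case by simp
next
  case (step y z)
  from \<open>(y, z) \<in> B \<union> {(u, v), (v, u)}\<close> consider "(y, z) \<in> B" | "y = u" "z = v" | "y = v" "z = u"
    by blast
  then show ?case
  proof cases
    case 1
    with step.IH show ?thesis by (meson rtrancl_into_rtrancl)
  qed (use step.IH in auto)
qed

text \<open>Deleting the new edge leaves \<open>A\<close>, where its ends are not linked. If an old
  edge \<open>xy\<close> stopped being a bridge, the walk around it would have to cross
  \<open>uv\<close>; the rest of that walk together with \<open>xy\<close> would then link
  \<open>u\<close> and \<open>v\<close> inside \<open>A\<close>.\<close>

lemma bridged_insert_edge:
  assumes "bridged A" "sym A" "(u, v) \<notin> A\<^sup>*"
  shows "bridged (A \<union> {(u, v), (v, u)})"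
  unfolding bridged_def
proof (intro allI impI notI)
  fix x y
  let ?A = "A \<union> {(u, v), (v, u)}"
  assume xy: "(x, y) \<in> ?A" and reach: "(x, y) \<in> (?A - {(x, y), (y, x)})\<^sup>*"
  have vu: "(v, u) \<notin> A\<^sup>*" using assms sym_rtranclD by metis
  show False
  proof (cases "(x, y) \<in> {(u, v), (v, u)}")
    case True
    then have "(?A - {(x, y), (y, x)})\<^sup>* \<subseteq> A\<^sup>*" by (intro rtrancl_mono) auto
    with True reach vu assms(3) show False by auto
  next
    case False
    define B where "B = A - {(x, y), (y, x)}"
    have A: "(x, y) \<in> A" "(y, x) \<in> A" using False xy \<open>sym A\<close> by (auto dest: symD)
    have "sym B" using \<open>sym A\<close> by (auto simp: B_def sym_def)
    have "(?A - {(x, y), (y, x)})\<^sup>* \<subseteq> (B \<union> {(u, v), (v, u)})\<^sup>*"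
      by (intro rtrancl_mono) (auto simp: B_def)
    then have "(x, y) \<in> (B \<union> {(u, v), (v, u)})\<^sup>*" using reach by (rule subsetD)
    note rtrancl_insert_edge_cases[OF this]
    moreover have "(x, y) \<notin> B\<^sup>*" using A assms(1) unfolding bridged_def B_def by blast
    moreover have "B\<^sup>* \<subseteq> A\<^sup>*" by (intro rtrancl_mono) (auto simp: B_def)
    ultimately have "(x, u) \<in> A\<^sup>* \<and> (v, y) \<in> A\<^sup>* \<or> (x, v) \<in> A\<^sup>* \<and> (u, y) \<in> A\<^sup>*"
      by blast
    moreover have "(v, u) \<in> A\<^sup>*" if "(x, u) \<in> A\<^sup>*" "(v, y) \<in> A\<^sup>*"
      by (rule rtrancl_trans[OF rtrancl_into_rtrancl[OF that(2) A(2)] that(1)])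
    moreover have "(u, v) \<in> A\<^sup>*" if "(x, v) \<in> A\<^sup>*" "(u, y) \<in> A\<^sup>*"
      by (rule rtrancl_trans[OF rtrancl_into_rtrancl[OF that(2) A(2)] that(1)])
    ultimately show False using vu assms(3) by auto
  qed
qed

lemma rtrancl_closed_subset:
  assumes "(u, v) \<in> B\<^sup>*" "u \<in> S" "B \<inter> S \<times> (- S) = {}"
  shows "(u, v) \<in> (B \<inter> S \<times> S)\<^sup>* \<and> v \<in> S"
  using assms(1)
proof (induction rule: rtrancl_induct)
  case base
  then show ?case using assms(2) by simp
next
  case (step y z)
  then have "(y, z) \<in> B \<inter> S \<times> S" using assms(3) by blast
  with step show ?case by (auto intro: rtrancl_into_rtrancl)
qed

text \<open>A walk around an edge cannot leave the side on which the edge starts, so being a bridge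
  is decided on that side alone.\<close>

lemma bridged_split:
  assumes "bridged (A \<inter> S \<times> S)" "bridged (A \<inter> (- S) \<times> (- S))" "A \<inter> S \<times> (- S) = {}" "sym A"
  shows "bridged A"
proof -
  \<comment> \<open>Stated for a general \<open>R\<close> so that it applies to \<open>S\<close>
    and, by symmetry of \<open>A\<close>, to the complement of \<open>S\<close>.\<close>
  have "(u, v) \<notin> (A - {(u, v), (v, u)})\<^sup>*"
    if "(u, v) \<in> A" "u \<in> R" "A \<inter> R \<times> (- R) = {}" "bridged (A \<inter> R \<times> R)" for R u v
  proof
    assume "(u, v) \<in> (A - {(u, v), (v, u)})\<^sup>*"
    moreover have "(A - {(u, v), (v, u)}) \<inter> R \<times> (- R) = {}" using that(3) by blast
    ultimately have "(u, v) \<in> ((A - {(u, v), (v, u)}) \<inter> R \<times> R)\<^sup>*" "v \<in> R"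
      using rtrancl_closed_subset that(2) by metis+
    moreover have "(A - {(u, v), (v, u)}) \<inter> R \<times> R = (A \<inter> R \<times> R) - {(u, v), (v, u)}" by blast
    ultimately show False using that unfolding bridged_def by auto
  qed
  moreover have "A \<inter> (- S) \<times> (- (- S)) = {}" using assms(3,4) by (auto dest: symD)
  ultimately show ?thesis using assms(1,2,3) unfolding bridged_def[of A] by (metis ComplI)
qed

section \<open>The effect of a switch on reachability and bridges\<close>

lemma switch_preserves_reachability:
  fixes A :: "'a rel" and a b c d :: 'a
  defines "A\<^sub>0 \<equiv> A - {(a, b), (b, a), (c, d), (d, c)}"
  defines "A' \<equiv> A\<^sub>0 \<union> {(a, c), (c, a), (b, d), (d, b)}"
  assumes "sym A" "bridged A'" "(a, c) \<in> A\<^sup>*"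
    and "{a, b} \<inter> {c, d} = {}" "(a, c) \<notin> A" "(b, d) \<notin> A"
  shows "A \<subseteq> A'\<^sup>*"
proof -
  have sym0: "sym A\<^sub>0" and sym': "sym A'" using \<open>sym A\<close> by (auto simp: A\<^sub>0_def A'_def sym_def)
  \<comment> \<open>The new edges are absent from \<open>A\<close>, so \<open>A\<^sub>0\<close>
    survives the deletion of either one from \<open>A'\<close>. Since both are bridges of
    \<open>A'\<close>, their ends cannot be linked in \<open>A\<^sub>0\<close>.\<close>
  have "A\<^sub>0\<^sup>* \<subseteq> (A' - {(a, c), (c, a)})\<^sup>*" "A\<^sub>0\<^sup>* \<subseteq> (A' - {(b, d), (d, b)})\<^sup>*"
    using assms(3-) by (intro rtrancl_mono; auto simp: A\<^sub>0_def A'_def dest: symD)+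
  with \<open>bridged A'\<close> have ac: "(a, c) \<notin> A\<^sub>0\<^sup>*" and bd: "(b, d) \<notin> A\<^sub>0\<^sup>*"
    unfolding bridged_def A'_def by blast+
  have link: "(a, d) \<in> A\<^sub>0\<^sup>* \<or> (b, c) \<in> A\<^sub>0\<^sup>*"
  proof (rule ccontr)
    assume none: "\<not> ?thesis"
    \<comment> \<open>Invariant along a walk of \<open>A\<close> from \<open>a\<close>: a deleted
      arc either ends in \<open>a\<close> or \<open>b\<close>, where the claim is trivial, or starts
      in \<open>c\<close> or \<open>d\<close>, which the invariant and the four excluded links rule
      out. At \<open>y = c\<close> this is absurd.\<close>
    have "(a, y) \<in> A\<^sub>0\<^sup>* \<or> (b, y) \<in> A\<^sub>0\<^sup>*" if "(a, y) \<in> A\<^sup>*" for y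
      using that
    proof (induction rule: rtrancl_induct)
      case base
      then show ?case by simp
    next
      case (step y z)
      then have "(y, z) \<in> A\<^sub>0 \<or> z \<in> {a, b} \<or> y \<in> {c, d}" by (auto simp: A\<^sub>0_def)
      with step.IH none ac bd show ?case by (auto intro: rtrancl_into_rtrancl)
    qed
    with \<open>(a, c) \<in> A\<^sup>*\<close> ac none show False by blast
  qed
  have sub: "A\<^sub>0\<^sup>* \<subseteq> A'\<^sup>*" by (intro rtrancl_mono) (auto simp: A'_def)
  have new: "(a, c) \<in> A'\<^sup>*" "(d, b) \<in> A'\<^sup>*" "(c, a) \<in> A'\<^sup>*" "(b, d) \<in> A'\<^sup>*" by (auto simp: A'_def)
  \<comment> \<open>With the two new edges the link forms a walk through all four vertices, in the
    order \<open>c a d b\<close> or \<open>a c b d\<close>; it replaces both deleted edges.\<close>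
  from link sub have "(a, d) \<in> A'\<^sup>* \<or> (c, b) \<in> A'\<^sup>*" using sym_rtranclD[OF sym'] by blast
  with new have "(a, b) \<in> A'\<^sup>*" "(c, d) \<in> A'\<^sup>*" by (meson rtrancl_trans)+
  moreover from this have "(b, a) \<in> A'\<^sup>*" "(d, c) \<in> A'\<^sup>*"
    using sym_rtranclD[OF sym'] by blast+
  moreover have "A \<subseteq> A\<^sub>0 \<union> {(a, b), (b, a), (c, d), (d, c)}" by (auto simp: A\<^sub>0_def)
  moreover have "A\<^sub>0 \<subseteq> A'\<^sup>*" using sub by blast
  ultimately show ?thesis by blast
qed

text \<open>The delicate point is that \<open>b\<close> and \<open>d\<close> are still unlinked once
  \<open>ac\<close> has been added. A walk between them using \<open>ac\<close> would link
  \<open>b\<close> in \<open>A\<^sub>0\<close> either to \<open>a\<close>, impossible because the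
  bridge \<open>ab\<close> is deleted, or to \<open>c\<close>, impossible because \<open>A\<close>
  itself does not link them.\<close>

lemma bridged_switch_separate:
  fixes A :: "'a rel" and a b c d :: 'a
  defines "A\<^sub>0 \<equiv> A - {(a, b), (b, a), (c, d), (d, c)}"
  assumes "sym A" "bridged A" "(a, c) \<notin> A\<^sup>*" "(a, b) \<in> A" "(c, d) \<in> A"
  shows "bridged (A\<^sub>0 \<union> {(a, c), (c, a), (b, d), (d, b)})"
proof -
  have sym0: "sym A\<^sub>0" using \<open>sym A\<close> by (auto simp: A\<^sub>0_def sym_def)
  have sub: "A\<^sub>0\<^sup>* \<subseteq> A\<^sup>*" by (intro rtrancl_mono) (auto simp: A\<^sub>0_def)
  have ac: "(a, c) \<notin> A\<^sub>0\<^sup>*" using sub assms by blast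
  let ?A1 = "A\<^sub>0 \<union> {(a, c), (c, a)}"
  have 1: "bridged ?A1"
    using bridged_insert_edge[OF _ sym0 ac] bridged_subset[OF \<open>bridged A\<close>] by (simp add: A\<^sub>0_def)
  have "A\<^sub>0\<^sup>* \<subseteq> (A - {(a, b), (b, a)})\<^sup>*" by (intro rtrancl_mono) (auto simp: A\<^sub>0_def)
  then have "(a, b) \<notin> A\<^sub>0\<^sup>*" using \<open>bridged A\<close> \<open>(a, b) \<in> A\<close> unfolding bridged_def by blast
  then have ba: "(b, a) \<notin> A\<^sub>0\<^sup>*" using sym_rtranclD[OF sym0] by blast
  have *: "(b, a) \<in> A" "(d, c) \<in> A" using assms by (auto dest: symD)
  have "(b, d) \<notin> A\<^sup>*" "(b, c) \<notin> A\<^sup>*"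
    using assms * by (meson converse_rtrancl_into_rtrancl rtrancl_into_rtrancl)+
  with sub have bd: "(b, d) \<notin> ?A1\<^sup>*" using ba rtrancl_insert_edge_cases[of b d A\<^sub>0 a c] by blast
  have sym1: "sym ?A1" using sym0 by (auto simp: sym_def)
  have "A\<^sub>0 \<union> {(a, c), (c, a), (b, d), (d, b)} = ?A1 \<union> {(b, d), (d, b)}" by blast
  then show ?thesis using bridged_insert_edge[OF 1 sym1 bd] by simp
qed

section \<open>Cycles, connectedness and components of a pair graph\<close>

context pair_graph
begin

lemma sym_parcs: "sym (parcs G)"
  by (rule symI) (rule arcs_symmetric)

text \<open>The remainder \<open>p\<close> runs from \<open>v\<close> to \<open>u\<close> without
  repeating a vertex. Using \<open>(u, v)\<close> again would revisit \<open>v\<close>. The arc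
  \<open>(v, u)\<close> could only be the first of \<open>p\<close>, and the rest would be a
  nonempty closed path at \<open>u\<close>; the length bound excludes the back-and-forth
  cycle.\<close>

lemma cycle_Cons_avoids_first_edge:
  assumes "cycle ((u, v) # p)" "length p \<ge> 2"
  shows "(u, v) \<notin> set p" "(v, u) \<notin> set p"
proof -
  have walk: "awalk v p u" and dist: "distinct (pawalk_verts v p)" and "(u, v) \<in> parcs G"
    using assms(1) by (auto simp: cycle_def awalk_Cons_iff)
  obtain e q where p: "p = e # q" and "q \<noteq> []"
    using assms(2) by (cases p rule: list_exhaust_NSC) auto
  have v: "fst e = v" "v \<notin> set (pawalk_verts (snd e) q)" and q: "awalk (snd e) q u"
    using walk dist p by (auto simp: awalk_Cons_iff)
  have "u \<noteq> v" using \<open>(u, v) \<in> parcs G\<close> no_loops' by blast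
  moreover have "(u, v) \<notin> set q" using awalk_verts_arc2[OF q] v by fastforce
  ultimately show "(u, v) \<notin> set p" using p v(1) by (metis fst_conv set_ConsD)
  have "(v, u) \<notin> set q" using awalk_verts_arc1[of "(v, u)" q "snd e"] v by auto
  moreover have "e \<noteq> (v, u)"
  proof
    assume "e = (v, u)"
    then have "apath u q u" using q dist p by (simp add: apath_def)
    then show False using \<open>q \<noteq> []\<close> apath_nonempty_ends by blast
  qed
  ultimately show "(v, u) \<notin> set p" using p by auto
qed

lemma simple_forest_iff_bridged: "simple_forest G \<longleftrightarrow> bridged (parcs G)"
proof -
  have "\<not> bridged (parcs G)" if cyc: "cycle p" and len: "length p \<ge> 3" for p
  proof -
    obtain u v q where p: "p = (u, v) # q" using len by (cases p) auto
    have q: "set q \<subseteq> parcs G - {(u, v), (v, u)}"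
      using cycle_Cons_avoids_first_edge[of u v q] cyc len p by (auto simp: cycle_def awalk_def)
    have "(x, y) \<in> (set q)\<^sup>*" if "pcas x q y" for x y
      using that
    proof (induction q arbitrary: x)
      case (Cons e q)
      then have "(snd e, y) \<in> (set q)\<^sup>*" by simp
      then have "(snd e, y) \<in> (set (e # q))\<^sup>*" by (rule rtrancl_mono[THEN subsetD, rotated]) auto
      moreover have "(x, snd e) \<in> set (e # q)" using Cons.prems by auto
      ultimately show ?case by (rule converse_rtrancl_into_rtrancl[rotated])
    qed simp
    moreover have "pcas v q u" using cyc p by (auto simp: cycle_def awalk_def)
    \<comment> \<open>The rest of the cycle runs from \<open>v\<close> to \<open>u\<close>, so the
      arc that violates \<open>bridged\<close> is the reverse of the first one.\<close>
    ultimately have "(v, u) \<in> (parcs G - {(u, v), (v, u)})\<^sup>*" using q rtrancl_mono by blast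
    moreover have "(v, u) \<in> parcs G" using cyc p by (auto simp: cycle_def awalk_def arcs_symmetric)
    ultimately show ?thesis unfolding bridged_def by (metis insert_commute)
  qed
  moreover have "\<exists>p. cycle p \<and> length p \<ge> 3" if "\<not> bridged (parcs G)"
  proof -
    from that obtain v u where vu: "(v, u) \<in> parcs G"
      and reach: "(v, u) \<in> (parcs G - {(v, u), (u, v)})\<^sup>*" unfolding bridged_def by blast
    \<comment> \<open>As a graph of its own, \<open>H\<close> allows the walk around the edge to be
      shortened to a path, whose distinct vertices are what \<open>cycle\<close> demands.\<close>
    define H where "H = \<lparr> pverts = pverts G, parcs = parcs G - {(v, u), (u, v)} \<rparr>"
    interpret H: pair_wf_digraph H
      using wellformed' by unfold_locales (auto simp: H_def)
    have "v \<rightarrow>\<^sup>*\<^bsub>with_proj H\<^esub> u" using reach vu H.reachable_conv' wellformed' by (simp add: H_def)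
    then obtain p where p: "H.apath v p u" using H.reachable_apath by blast
    have "v \<noteq> u" using vu no_loops' by blast
    have walk: "set p \<subseteq> parcs G - {(v, u), (u, v)}" "pcas v p u" "distinct (pawalk_verts v p)"
      using p by (auto simp: H.apath_def H.awalk_def) (auto simp: H_def)
    \<comment> \<open>A path of length 1 would be the deleted arc \<open>(v, u)\<close>
      itself.\<close>
    with \<open>v \<noteq> u\<close> have "length p \<ge> 2"
      by (cases p rule: list_exhaust_NSC) auto
    moreover have "cycle ((u, v) # p)"
      using walk vu wellformed' arcs_symmetric
      unfolding cycle_def awalk_def by (intro exI[of _ u]) auto
    ultimately show ?thesis by (intro exI[of _ "(u, v) # p"]) simp
  qed
  ultimately show ?thesis using pair_graph unfolding simple_forest_def by blast
qed

lemma connected_iff: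
  "Digraph_Component.connected (with_proj G) \<longleftrightarrow>
     pverts G \<noteq> {} \<and> (\<forall>u \<in> pverts G. \<forall>v \<in> pverts G. (u, v) \<in> (parcs G)\<^sup>*)"
proof -
  \<comment> \<open>Connectedness is strong connectedness of the symmetric closure, here the graph
    itself.\<close>
  have "mk_symmetric (with_proj G) = G"
    using arcs_symmetric by (force simp: mk_symmetric_def intro: pair_pre_digraph.equality)
  then show ?thesis
    unfolding connected_def strongly_connected_def by (auto simp: reachable_conv')
qed

text \<open>Opens the way to the description of strong components by reachability. Adding arcs keeps
  a graph connected, so a maximal connected \<open>H\<close> is induced, hence symmetric and
  strongly connected; its maximality carries over because strongly connected graphs are
  connected.\<close>

lemma max_connected_in_sccs:
  assumes "max_subgraph Digraph_Component.connected H"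
  shows "H \<in> sccs"
proof -
  have sub: "subgraph H (with_proj G)" using assms by (rule subgraphI_max_subgraph)
  have "arc_mono Digraph_Component.connected"
    by (auto simp: arc_mono_def) (metis spanning_def subgraphE wf_digraph.connected_spanning_imp_connected)
  then have ind: "induced_subgraph H (with_proj G)" using assms induced_subgraphI_arc_mono by blast
  then have "symmetric H" using sym_arcs induced_graph_imp_symmetric by blast
  moreover have "wf_digraph H" using sub by auto
  ultimately have "strongly_connected H"
    using assms by (auto dest: max_subgraph_prop intro: wf_digraph.symmetric_connected_imp_strongly_connected)
  moreover have "Digraph_Component.connected K" if "strongly_connected K" for K :: "('a, 'a \<times> 'a) pre_digraph"
    using that rtrancl_on_mono[of "arcs_ends K" "(arcs_ends K)\<^sup>s" "verts K" "verts K"]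
    unfolding connected_conv strongly_connected_def reachable_def by (simp add: symcl_def)
  ultimately show ?thesis
    unfolding sccs_altdef2 using assms max_subgraph_mp by blast
qed

end

section \<open>Switches and components in terms of vertices and arcs\<close>

lemma pair_graph_iff:
  "pair_graph G \<longleftrightarrow>
     finite (pverts G) \<and> parcs G \<subseteq> pverts G \<times> pverts G \<and> sym (parcs G) \<and> irrefl (parcs G)"
proof
  assume "pair_graph G"
  then interpret pair_graph G .
  show "finite (pverts G) \<and> parcs G \<subseteq> pverts G \<times> pverts G \<and> sym (parcs G) \<and> irrefl (parcs G)"
    using pair_finite_verts sym_parcs by (auto simp: irrefl_def dest: wellformed' no_loops')
next
  assume G: "finite (pverts G) \<and> parcs G \<subseteq> pverts G \<times> pverts G \<and> sym (parcs G) \<and> irrefl (parcs G)"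
  then have "finite (parcs G)" by (auto intro: finite_subset[OF _ finite_cartesian_product])
  with G show "pair_graph G"
    by unfold_locales (auto simp: irrefl_def symmetric_def)
qed

lemma (in pair_graph) in_uedges_iff: "{u, v} \<in> uedges G \<longleftrightarrow> (u, v) \<in> parcs G"
  unfolding uedges_def by (auto simp: doubleton_eq_iff dest: arcs_symmetric)

lemma (in pair_graph) interchangeable_iff:
  "interchangeable a b c d G \<longleftrightarrow>
     (a, b) \<in> parcs G \<and> (c, d) \<in> parcs G \<and> {a, b} \<inter> {c, d} = {} \<and>
     (a, c) \<notin> parcs G \<and> (b, d) \<notin> parcs G"
  unfolding interchangeable_def in_uedges_iff ..

lemma two_switch_sel:
  assumes "interchangeable a b c d G"
  shows "pverts (two_switch a b c d G) = pverts G"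
    and "parcs (two_switch a b c d G) =
      parcs G - {(a, b), (b, a), (c, d), (d, c)} \<union> {(a, c), (c, a), (b, d), (d, b)}"
  using assms by (simp_all add: two_switch_def)

lemma pair_graph_two_switch:
  assumes "pair_graph G"
  shows "pair_graph (two_switch a b c d G)"
proof (cases "interchangeable a b c d G")
  case True
  interpret pair_graph G by fact
  have ends: "{a, b, c, d} \<subseteq> pverts G" "a \<noteq> c" "b \<noteq> d"
    using True wellformed' by (auto simp: interchangeable_iff)
  have "sym (parcs (two_switch a b c d G))"
    using sym_parcs by (auto simp: two_switch_sel[OF True] sym_def)
  moreover have "irrefl (parcs (two_switch a b c d G))"
    using ends no_loops' by (auto simp: two_switch_sel[OF True] irrefl_def)
  moreover have "parcs (two_switch a b c d G) \<subseteq> pverts G \<times> pverts G"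
    using ends wellformed' unfolding two_switch_sel[OF True] by auto
  ultimately show ?thesis
    using pair_finite_verts by (simp add: pair_graph_iff two_switch_sel(1)[OF True])
qed (simp add: two_switch_def assms)

lemma component_ofD:
  assumes "pair_graph G" "component_of T G"
  shows "pair_graph T"
    and "parcs T = parcs G \<inter> pverts T \<times> pverts T"
    and "Digraph_Component.connected (with_proj T)"
    and "\<And>u v. u \<in> pverts T \<Longrightarrow> (u, v) \<in> (parcs G)\<^sup>* \<longleftrightarrow> v \<in> pverts T"
proof -
  interpret pair_graph G by fact
  have max: "max_subgraph Digraph_Component.connected (with_proj T)"
    using assms(2) by (simp add: component_of_def)
  then show "Digraph_Component.connected (with_proj T)" by (rule max_subgraph_prop)
  have scc: "with_proj T \<in> sccs" using max by (rule max_connected_in_sccs)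
  then have "induced_subgraph (with_proj T) (with_proj G)" by (rule in_sccs_imp_induced)
  then show arcs: "parcs T = parcs G \<inter> pverts T \<times> pverts T"
    unfolding induced_subgraph_def by force
  have verts: "pverts T \<subseteq> pverts G"
    using max subgraph_imp_subverts[OF subgraphI_max_subgraph] by fastforce
  show "pair_graph T"
    using \<open>pair_graph G\<close> verts arcs finite_subset[OF verts]
    by (auto simp: pair_graph_iff sym_def irrefl_def)
  have S: "pverts T \<in> sccs_verts" using scc in_sccs_vertsI_sccs by force
  fix u v assume u: "u \<in> pverts T"
  show "(u, v) \<in> (parcs G)\<^sup>* \<longleftrightarrow> v \<in> pverts T"
  proof -
    \<comment> \<open>The closure is reflexive even outside the vertex set; it agrees with graph
      reachability because \<open>u\<close> is a vertex of \<open>G\<close>.\<close>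
    have "(u, v) \<in> (parcs G)\<^sup>* \<longleftrightarrow> u \<rightarrow>\<^sup>*\<^bsub>with_proj G\<^esub> v" using u verts reachable_conv' by blast
    also have "\<dots> \<longleftrightarrow> v \<in> pverts T"
      using S u symmetric_reachable'[of u v] unfolding in_sccs_verts_conv_reachable by blast
    finally show ?thesis .
  qed
qed

lemma component_of_eqI:
  assumes "pair_graph G" "component_of T\<^sub>1 G" "component_of T\<^sub>2 G"
    and "v \<in> pverts T\<^sub>1" "v \<in> pverts T\<^sub>2"
  shows "T\<^sub>1 = T\<^sub>2"
proof -
  have "pverts T\<^sub>1 = pverts T\<^sub>2"
    using component_ofD(4)[OF assms(1,2)] component_ofD(4)[OF assms(1,3)] assms(4,5) by blast
  then show ?thesis
    using component_ofD(2)[OF assms(1,2)] component_ofD(2)[OF assms(1,3)] by simp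
qed

section \<open>The two cases of the theorem\<close>

lemma f_switch_iff_t_switch:
  assumes "simple_forest F" "interchangeable a b c d F" "component_of T F"
    and "(a, b) \<in> parcs T" "(c, d) \<in> parcs T"
  shows "f_switch a b c d F \<longleftrightarrow> t_switch a b c d T"
proof -
  let ?F' = "two_switch a b c d F" and ?T' = "two_switch a b c d T"
  define S where "S = pverts T"
  interpret F: pair_graph F using assms(1) by (simp add: simple_forest_def)
  note T = component_ofD[OF F.pair_graph assms(3)]
  interpret T: pair_graph T by (rule T(1))
  interpret F': pair_graph ?F' using F.pair_graph by (rule pair_graph_two_switch)
  interpret T': pair_graph ?T' using T.pair_graph by (rule pair_graph_two_switch)
  have S: "a \<in> S" "b \<in> S" "c \<in> S" "d \<in> S"
    using assms(4,5) T.wellformed' by (auto simp: S_def)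
  have iT: "interchangeable a b c d T"
    using assms(2,4,5) T(2) by (auto simp: F.interchangeable_iff T.interchangeable_iff)
  have treeT: "simple_tree T"
    using assms(1) T(2,3) bridged_subset[of "parcs F" "parcs T"]
    by (simp add: simple_tree_def F.simple_forest_iff_bridged T.simple_forest_iff_bridged)
  have out: "parcs F \<inter> S \<times> (- S) = {}"
    using T(4) by (auto simp: S_def)
  \<comment> \<open>All four ends lie in \<open>S\<close>, so switching commutes with restriction to
    the component.\<close>
  have T'_eq: "parcs ?T' = parcs ?F' \<inter> S \<times> S"
    using S T(2) by (auto simp: two_switch_sel[OF assms(2)] two_switch_sel[OF iT] S_def)
  have "bridged (parcs ?F')" if "bridged (parcs ?T')"
  proof (rule bridged_split)
    show "bridged (parcs ?F' \<inter> S \<times> S)" using that T'_eq by simp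
    have "parcs ?F' \<inter> (- S) \<times> (- S) \<subseteq> parcs F"
      using S by (auto simp: two_switch_sel[OF assms(2)])
    then show "bridged (parcs ?F' \<inter> (- S) \<times> (- S))"
      using assms(1) bridged_subset F.simple_forest_iff_bridged by blast
    show "parcs ?F' \<inter> S \<times> (- S) = {}"
      using S out by (auto simp: two_switch_sel[OF assms(2)])
  qed (rule F'.sym_parcs)
  moreover have "bridged (parcs ?T')" if "bridged (parcs ?F')"
    using bridged_subset[OF that] T'_eq by blast
  \<comment> \<open>A t-switch also demands connectedness; acyclicity of the result already forces
    it, since every old arc of \<open>T\<close> is replaced by a walk.\<close>
  moreover have "Digraph_Component.connected (with_proj ?T')" if "bridged (parcs ?T')"
  proof -
    have conn: "pverts T \<noteq> {}" "\<And>u v. u \<in> pverts T \<Longrightarrow> v \<in> pverts T \<Longrightarrow> (u, v) \<in> (parcs T)\<^sup>*"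
      using T(3) T.connected_iff by auto
    have "parcs T \<subseteq> (parcs ?T')\<^sup>*"
      using switch_preserves_reachability[of "parcs T" a b c d] that conn(2)[of a c] S iT
        T.sym_parcs
      by (auto simp: two_switch_sel[OF iT] T.interchangeable_iff S_def)
    then have "(parcs T)\<^sup>* \<subseteq> (parcs ?T')\<^sup>*" by (rule rtrancl_subset_rtrancl)
    then show ?thesis using conn by (auto simp: T'.connected_iff two_switch_sel(1)[OF iT])
  qed
  ultimately show ?thesis
    using assms(1,2) iT treeT
    unfolding f_switch_def t_switch_def simple_tree_def[of ?T']
        F'.simple_forest_iff_bridged T'.simple_forest_iff_bridged
    by blast
qed

lemma f_switch_separate_components:
  assumes "simple_forest F" "interchangeable a b c d F" "(a, c) \<notin> (parcs F)\<^sup>*"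
  shows "f_switch a b c d F"
proof -
  interpret F: pair_graph F using assms(1) by (simp add: simple_forest_def)
  interpret F': pair_graph "two_switch a b c d F"
    using F.pair_graph by (rule pair_graph_two_switch)
  have "bridged (parcs (two_switch a b c d F))"
    unfolding two_switch_sel[OF assms(2)]
    using assms F.sym_parcs F.simple_forest_iff_bridged F.interchangeable_iff
    by (intro bridged_switch_separate) auto
  then show ?thesis using assms by (simp add: f_switch_def F'.simple_forest_iff_bridged)
qed

theorem theorem5:
  fixes F :: "'a pair_pre_digraph" and e\<^sub>1 e\<^sub>2 :: "'a set" and a b c d :: 'a
  assumes "simple_forest F"
    and "e\<^sub>1 \<in> uedges F" and "e\<^sub>2 \<in> uedges F" and "e\<^sub>1 \<inter> e\<^sub>2 = {}"
    and "interchangeable a b c d F" and "e\<^sub>1 = {a, b}" and "e\<^sub>2 = {c, d}"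
  shows "(\<forall>T. component_of T F \<and> e\<^sub>1 \<in> uedges T \<and> e\<^sub>2 \<in> uedges T \<longrightarrow>
              (f_switch a b c d F \<longleftrightarrow> t_switch a b c d T)) \<and>
         ((\<exists>T\<^sub>1 T\<^sub>2. component_of T\<^sub>1 F \<and> component_of T\<^sub>2 F \<and> T\<^sub>1 \<noteq> T\<^sub>2 \<and>
                   e\<^sub>1 \<in> uedges T\<^sub>1 \<and> e\<^sub>2 \<in> uedges T\<^sub>2) \<longrightarrow>
              f_switch a b c d F)"
proof (intro conjI allI impI)
  have F: "pair_graph F" using assms(1) by (simp add: simple_forest_def)
  fix T assume "component_of T F \<and> e\<^sub>1 \<in> uedges T \<and> e\<^sub>2 \<in> uedges T"
  then show "f_switch a b c d F \<longleftrightarrow> t_switch a b c d T"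
    using assms pair_graph.in_uedges_iff[OF component_ofD(1)[OF F]]
    by (intro f_switch_iff_t_switch) auto
next
  have F: "pair_graph F" using assms(1) by (simp add: simple_forest_def)
  assume "\<exists>T\<^sub>1 T\<^sub>2. component_of T\<^sub>1 F \<and> component_of T\<^sub>2 F \<and> T\<^sub>1 \<noteq> T\<^sub>2 \<and>
    e\<^sub>1 \<in> uedges T\<^sub>1 \<and> e\<^sub>2 \<in> uedges T\<^sub>2"
  then obtain T\<^sub>1 T\<^sub>2 where T: "component_of T\<^sub>1 F" "component_of T\<^sub>2 F" "T\<^sub>1 \<noteq> T\<^sub>2"
    "e\<^sub>1 \<in> uedges T\<^sub>1" "e\<^sub>2 \<in> uedges T\<^sub>2" by blast
  interpret T\<^sub>1: pair_graph T\<^sub>1 by (rule component_ofD(1)[OF F T(1)])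
  interpret T\<^sub>2: pair_graph T\<^sub>2 by (rule component_ofD(1)[OF F T(2)])
  have "a \<in> pverts T\<^sub>1" "c \<in> pverts T\<^sub>2"
    using T(4,5) assms(6,7) T\<^sub>1.in_uedges_iff T\<^sub>2.in_uedges_iff T\<^sub>1.wellformed' T\<^sub>2.wellformed' by blast+
  \<comment> \<open>Were \<open>c\<close> reachable from \<open>a\<close>, it would lie in both
    components, which would then coincide.\<close>
  then have "(a, c) \<notin> (parcs F)\<^sup>*"
    using component_ofD(4)[OF F T(1)] component_of_eqI[OF F T(1,2)] T(3) by blast
  then show "f_switch a b c d F"
    by (rule f_switch_separate_components[OF assms(1,5)])
qed

end
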